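(* Let $R(a,b)$ ($a$ a non-negative integer, $b\in\mathbb{C}$) be any finite dimensional irreducible representation of the Lie superalgebra $SU(2/1)$, with highest weight vector $|\Lambda\rangle$ satisfying $H|\Lambda\rangle=a|\Lambda\rangle$, $\tfrac12(Y+H)|\Lambda\rangle=b|\Lambda\rangle$, $E|\Lambda\rangle=U|\Lambda\rangle=0$, and let $\chi$ be its chirality operator normalized by $\chi|\Lambda\rangle=|\Lambda\rangle$. Then the operator $T^-=(UV+WX)(VU+XW)$ satisfies on $R(a,b)$ $$T^-=(UV+WX)(VU+XW)=\tfrac12\,(1-\chi)\,C_2 .$$
   Context: $SU(2/1)$ denotes the complex Lie superalgebra $sl(2/1,\mathbb{C})$ with even generators $F,H,E,Y$ and odd generators $U,V,W,X$ and relations: $[H,E]=2E$, $[H,F]=-2F$, $[E,F]=H$, $Y$ commutes with $E,F,H$; $[H,U]=-U$, $[H,W]=W$, $[H,X]=-X$, $[H,V]=V$; $[Y,U]=U$, $[Y,W]=W$, $[Y,V]=-V$, $[Y,X]=-X$; $[E,U]=W$, $[F,W]=U$, $[E,X]=-V$, $[F,V]=-X$, $[E,V]=[E,W]=[F,U]=[F,X]=0$; $\{U,V\}=\tfrac12(Y+H)$, $\{W,X\}=\tfrac12(Y-H)$, $\{U,X\}=-F$, $\{V,W\}=-E$, $\{U,W\}=\{X,V\}=0$, and $U,V,W,X$ square to zero in the enveloping algebra. The chirality operator $\chi$ of an irreducible representation is the grading operator: $\chi^2=1$, $\chi$ commutes with $F,H,E,Y$ and anticommutes with $U,V,W,X$;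 its overall sign is fixed by requiring the value $+1$ on the highest weight vector. The quadratic Casimir is $C_2=-\tfrac14\big(H^2-Y^2+2(EF+FE)+2(UV-VU)+2(WX-XW)\big)$. *)

theory Defs
  imports Complex_Main "HOL-Library.Function_Algebras"
begin

text \<open>
  Operators on the representation space are plain functions; \<open>+\<close>, \<open>-\<close> and \<open>0\<close> on them are
  pointwise (\<open>Function_Algebras\<close>). Their product is composition, here under a notation that binds
  tighter than \<open>+\<close>, unlike \<open>\<circ>\<close>. Scalar multiples are written \<open>scale c \<cdot> A\<close>.
\<close>

abbreviation op_mult :: "('v \<Rightarrow> 'v) \<Rightarrow> ('v \<Rightarrow> 'v) \<Rightarrow> 'v \<Rightarrow> 'v" (infixl "\<cdot>" 75) where
  "A \<cdot> B \<equiv> A \<circ> B"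

definition comm :: "('v::ab_group_add \<Rightarrow> 'v) \<Rightarrow> ('v \<Rightarrow> 'v) \<Rightarrow> 'v \<Rightarrow> 'v" where
  "comm A B = A \<cdot> B - B \<cdot> A"

definition acomm :: "('v::ab_group_add \<Rightarrow> 'v) \<Rightarrow> ('v \<Rightarrow> 'v) \<Rightarrow> 'v \<Rightarrow> 'v" where
  "acomm A B = A \<cdot> B + B \<cdot> A"

text \<open>
  A finite-dimensional representation of $sl(2/1,\mathbb{C})$, given by the action of the eight
  basis elements. The relations below determine all the brackets of the superalgebra, so these are
  exactly the Lie superalgebra homomorphisms into the operators on the space. \<open>Basis\<close> is an
  arbitrary finite basis of the space; it only expresses finite-dimensionality.
\<close>

locale sl21_rep = finite_dimensional_vector_space scale Basis
  for scale :: "complex \<Rightarrow> 'v::ab_group_add \<Rightarrow> 'v"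
    and Basis :: "'v set" +
  fixes F H E Y U V W X :: "'v \<Rightarrow> 'v"
  assumes linear_even:
      "Vector_Spaces.linear scale scale F" "Vector_Spaces.linear scale scale H"
      "Vector_Spaces.linear scale scale E" "Vector_Spaces.linear scale scale Y"
    and linear_odd:
      "Vector_Spaces.linear scale scale U" "Vector_Spaces.linear scale scale V"
      "Vector_Spaces.linear scale scale W" "Vector_Spaces.linear scale scale X"
    and even_even:
      "comm H E = scale 2 \<cdot> E" "comm H F = scale (-2) \<cdot> F" "comm E F = H"
      "comm Y E = 0" "comm Y F = 0" "comm Y H = 0"
    and H_odd: "comm H U = - U" "comm H W = W" "comm H X = - X" "comm H V = V"
    and Y_odd: "comm Y U = U" "comm Y W = W" "comm Y V = - V" "comm Y X = - X"
    and E_odd: "comm E U = W" "comm E X = - V" "comm E V = 0" "comm E W = 0"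
    and F_odd: "comm F W = U" "comm F V = - X" "comm F U = 0" "comm F X = 0"
    and odd_odd:
      "acomm U V = scale (1/2) \<cdot> (Y + H)" "acomm W X = scale (1/2) \<cdot> (Y - H)"
      "acomm U X = - F" "acomm V W = - E" "acomm U W = 0" "acomm X V = 0"
    and odd_square: "U \<cdot> U = 0" "V \<cdot> V = 0" "W \<cdot> W = 0" "X \<cdot> X = 0"

text \<open>
  The representation space of a Lie superalgebra is $\mathbb{Z}/2$-graded; \<open>chi\<close> is the grading
  operator, with the even and odd parts as its $\pm 1$ eigenspaces in an order that is left open
  here (both \<open>chi\<close> and \<open>- chi\<close> qualify).
\<close>

locale sl21_graded_rep = sl21_rep scale Basis F H E Y U V W X
  for scale :: "complex \<Rightarrow> 'v::ab_group_add \<Rightarrow> 'v"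
    and Basis :: "'v set" and F H E Y U V W X :: "'v \<Rightarrow> 'v" +
  fixes chi :: "'v \<Rightarrow> 'v"
  assumes linear_chi: "Vector_Spaces.linear scale scale chi"
    and chi_square: "chi \<cdot> chi = id"
    and chi_even: "comm chi F = 0" "comm chi H = 0" "comm chi E = 0" "comm chi Y = 0"
    and chi_odd: "acomm chi U = 0" "acomm chi V = 0" "acomm chi W = 0" "acomm chi X = 0"
begin

text \<open>
  Submodules are graded, as usual for superalgebras. Since \<open>chi\<close> is an involution, invariance
  under it says that a subspace is the sum of its intersections with the two parts.
\<close>

definition submodule :: "'v set \<Rightarrow> bool" where
  "submodule S \<longleftrightarrow> subspace S \<and> (\<forall>A \<in> {F, H, E, Y, U, V, W, X, chi}. A ` S \<subseteq> S)"

end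

locale sl21_irrep = sl21_graded_rep scale Basis F H E Y U V W X chi
  for scale :: "complex \<Rightarrow> 'v::ab_group_add \<Rightarrow> 'v"
    and Basis :: "'v set" and F H E Y U V W X chi :: "'v \<Rightarrow> 'v" +
  assumes nonzero: "UNIV \<noteq> {0 :: 'v}"
    and irreducible: "submodule S \<Longrightarrow> S = {0} \<or> S = UNIV"

definition casimir ::
  "(complex \<Rightarrow> 'v::ab_group_add \<Rightarrow> 'v) \<Rightarrow> ('v \<Rightarrow> 'v) \<Rightarrow> ('v \<Rightarrow> 'v) \<Rightarrow> ('v \<Rightarrow> 'v) \<Rightarrow> ('v \<Rightarrow> 'v) \<Rightarrow>
    ('v \<Rightarrow> 'v) \<Rightarrow> ('v \<Rightarrow> 'v) \<Rightarrow> ('v \<Rightarrow> 'v) \<Rightarrow> ('v \<Rightarrow> 'v) \<Rightarrow> 'v \<Rightarrow> 'v" where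
  "casimir scale F H E Y U V W X =
    scale (-1/4) \<cdot> (H \<cdot> H - Y \<cdot> Y + scale 2 \<cdot> (E \<cdot> F + F \<cdot> E)
      + scale 2 \<cdot> (U \<cdot> V - V \<cdot> U) + scale 2 \<cdot> (W \<cdot> X - X \<cdot> W))"

definition highest_weight_vector ::
  "(complex \<Rightarrow> 'v::ab_group_add \<Rightarrow> 'v) \<Rightarrow> ('v \<Rightarrow> 'v) \<Rightarrow> ('v \<Rightarrow> 'v) \<Rightarrow> ('v \<Rightarrow> 'v) \<Rightarrow> ('v \<Rightarrow> 'v) \<Rightarrow>
    nat \<Rightarrow> complex \<Rightarrow> 'v \<Rightarrow> bool" where
  "highest_weight_vector scale H E Y U a b v \<longleftrightarrow>
    v \<noteq> 0 \<and> H v = scale (of_nat a) v \<and> scale (1/2) (Y v + H v) = scale b v \<and> E v = 0 \<and> U v = 0"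

end

theory Submission
  imports Defs
begin

text \<open>
  Let $L$ be the space of even vectors annihilated by $U$ and $W$; it is stable under
  $F, H, E, Y$. By the relations, $L + VL + XL + VXL$ is a graded submodule, and it contains
  $\Lambda$, hence it is the whole space. Since $T^-= UVXW + WXVU$, the operator $T^-$ vanishes on
  $L$ (killed by $U$ and $W$) and on $VXL$, and normal ordering on $VL$ and $XL$ turns it into the
  Casimir operator, while $\frac12(1-\chi)$ is the projection onto $VL + XL$.
\<close>

text \<open>Both orientations are kept because the normal order below picks one of them for each
  pair of generators.\<close>

lemma comm_swap:
  assumes "comm A B = C"
  shows "A (B x) = B (A x) + C x" "B (A x) = A (B x) - C x"
  using assms by (auto simp: comm_def)

lemma acomm_swap:
  assumes "acomm A B = C"
  shows "A (B x) = C x - B (A x)" "B (A x) = C x - A (B x)"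
  using assms by (auto simp: acomm_def)

context sl21_rep
begin

text \<open>
  Vector identities are proved by applying an arbitrary linear functional, which reduces them to
  ring identities over the complex numbers.
\<close>

lemma eq_by_functionals:
  assumes "\<And>f. Vector_Spaces.linear scale (*) f \<Longrightarrow> f x = f y"
  shows "x = y"
proof -
  \<comment> \<open>Coordinates with respect to \<open>Basis\<close> are linear functionals, and
    they determine a vector.\<close>
  have "representation Basis x = representation Basis y"
  proof
    fix c
    have "Vector_Spaces.linear scale (*) (\<lambda>v. representation Basis v c)"
      unfolding Vector_Spaces.linear_iff_module_hom module_hom_iff
      using module_axioms independent_Basis span_Basis
      by (auto simp: representation_add representation_scale module_def algebra_simps)
    then show "representation Basis x c = representation Basis y c" by (rule assms)
  qed
  then show ?thesis
    using independent_Basis span_Basis by (metis UNIV_I sum_nonzero_representation_eq)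
qed

lemmas hom_ops = linear_even[THEN module_hom_linearI] linear_odd[THEN module_hom_linearI]

lemmas op_linear =
  hom_ops[THEN module_hom.add] hom_ops[THEN module_hom.diff] hom_ops[THEN module_hom.neg]
  hom_ops[THEN module_hom.scale] hom_ops[THEN module_hom.zero]

text \<open>
  Oriented so as to sort every word in the generators into the order $V, X, F, H, Y, E, U, W$.
\<close>

lemmas normal_order =
  even_even(1)[THEN comm_swap(2)] even_even(2,3)[THEN comm_swap(1)]
  even_even(4)[THEN comm_swap(2)] even_even(5,6)[THEN comm_swap(1)]
  H_odd(1,2)[THEN comm_swap(2)] H_odd(3,4)[THEN comm_swap(1)]
  Y_odd(1,2)[THEN comm_swap(2)] Y_odd(3,4)[THEN comm_swap(1)]
  E_odd(1)[THEN comm_swap(2)] E_odd(2,3)[THEN comm_swap(1)] E_odd(4)[THEN comm_swap(2)]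
  F_odd(1)[THEN comm_swap(2)] F_odd(2)[THEN comm_swap(1)] F_odd(3)[THEN comm_swap(2)]
  F_odd(4)[THEN comm_swap(1)]
  odd_odd(1-3)[THEN acomm_swap(1)] odd_odd(4)[THEN acomm_swap(2)] odd_odd(6)[THEN acomm_swap(1)]

lemma odd_square_apply: "U (U x) = 0" "V (V x) = 0" "W (W x) = 0" "X (X x) = 0"
  using odd_square by (auto simp: fun_eq_iff)

lemmas rewrite_ops = normal_order odd_square_apply op_linear scale_right_distrib scale_right_diff_distrib

end

context sl21_graded_rep
begin

lemmas hom_chi = linear_chi[THEN module_hom_linearI]

lemmas chi_linear =
  hom_chi[THEN module_hom.add] hom_chi[THEN module_hom.diff] hom_chi[THEN module_hom.neg]
  hom_chi[THEN module_hom.scale] hom_chi[THEN module_hom.zero]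

text \<open>\<open>chi\<close> travels rightwards through a word until it meets the vector, picking
  up a sign at each odd generator.\<close>

lemmas chi_order = chi_even[THEN comm_swap(1)] chi_odd[THEN acomm_swap(1)]

lemmas rewrite_all = rewrite_ops chi_linear chi_order

definition even_top :: "'v set" where
  "even_top = {v. U v = 0 \<and> W v = 0 \<and> chi v = v}"

text \<open>Brackets of even generators with \<open>U\<close> and \<open>W\<close> stay in the span
  of \<open>U\<close> and \<open>W\<close>, and \<open>chi\<close> commutes with even
  generators.\<close>

lemma even_top_stable:
  assumes "v \<in> even_top"
  shows "F v \<in> even_top" "H v \<in> even_top" "Y v \<in> even_top" "E v \<in> even_top"
  using assms by (auto simp: even_top_def rewrite_all)

text \<open>Since \<open>V\<close> and \<open>X\<close> anticommute and square to zero, no further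
  words in them occur.\<close>

definition generators :: "'v set" where
  "generators = even_top \<union> V ` even_top \<union> X ` even_top \<union> (\<lambda>v. V (X v)) ` even_top"

lemma generators_memberI:
  assumes "v \<in> even_top"
  shows "v \<in> span generators" "V v \<in> span generators" "X v \<in> span generators"
    "V (X v) \<in> span generators"
  using assms by (auto simp: generators_def intro!: span_base)

lemma generators_cases:
  assumes "x \<in> generators"
  obtains v where "v \<in> even_top" "x = v" | v where "v \<in> even_top" "x = V v"
    | v where "v \<in> even_top" "x = X v" | v where "v \<in> even_top" "x = V (X v)"
  using assms by (auto simp: generators_def)

text \<open>Normal ordering brings \<open>V\<close> and \<open>X\<close> to the front, while
  \<open>U\<close> and \<open>W\<close> reach a vector of \<open>even_top\<close> and kill it; the
  even generators in between preserve \<open>even_top\<close>.\<close>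

lemma submodule_span_generators: "submodule (span generators)"
  unfolding submodule_def
proof (intro conjI ballI)
  fix A assume A: "A \<in> {F, H, E, Y, U, V, W, X, chi}"
  then have hom: "module_hom scale scale A"
    using hom_ops hom_chi by auto
  have "A x \<in> span generators" if x: "x \<in> generators" for x
  proof -
    have eq: "U v = 0" "W v = 0" "chi v = v" if "v \<in> even_top" for v
      using that by (auto simp: even_top_def)
    from x show ?thesis
      by (cases rule: generators_cases)
        (use A in \<open>auto simp: rewrite_all eq even_top_stable generators_memberI
          intro!: span_add span_diff span_neg span_scale span_zero\<close>)
  qed
  then have "span (A ` generators) \<subseteq> span generators"
    by (intro span_minimal) auto
  then show "A ` span generators \<subseteq> span generators"
    by (simp add: module_hom.span_image[OF hom])
qed simp

lemma T_minus_eq_on_generators: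
  assumes "x \<in> generators"
  shows "((U \<cdot> V + W \<cdot> X) \<cdot> (V \<cdot> U + X \<cdot> W)) x
    = (scale (1/2) \<cdot> (id - chi) \<cdot> casimir scale F H E Y U V W X) x"
proof (rule eq_by_functionals)
  fix f assume "Vector_Spaces.linear scale (*) f"
  then have hom: "module_hom scale (*) f" by (rule module_hom_linearI)
  note f_linear = hom[THEN module_hom.add] hom[THEN module_hom.diff] hom[THEN module_hom.neg]
    hom[THEN module_hom.scale] hom[THEN module_hom.zero]
  have eq: "U v = 0" "W v = 0" "chi v = v" if "v \<in> even_top" for v
    using that by (auto simp: even_top_def)
  from assms show "f (((U \<cdot> V + W \<cdot> X) \<cdot> (V \<cdot> U + X \<cdot> W)) x)
    = f ((scale (1/2) \<cdot> (id - chi) \<cdot> casimir scale F H E Y U V W X) x)"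
    \<comment> \<open>After sorting, \<open>U\<close>, \<open>W\<close> and \<open>chi\<close> act
      directly on \<open>v\<close> and disappear; the values of \<open>f\<close> on the remaining
      words are the atoms of the complex arithmetic.\<close>
    by (cases rule: generators_cases)
      (simp_all add: casimir_def rewrite_all eq f_linear field_simps)
qed

lemma T_minus_eq_on_span:
  assumes "x \<in> span generators"
  shows "((U \<cdot> V + W \<cdot> X) \<cdot> (V \<cdot> U + X \<cdot> W)) x
    = (scale (1/2) \<cdot> (id - chi) \<cdot> casimir scale F H E Y U V W X) x"
    (is "?T x = ?C x")
proof (rule module_pair.module_hom_eq_on_span[OF _ _ _ _ assms])
  show "module_pair scale scale"
    by (simp add: module_pair_def module_axioms)
  show "module_hom scale scale ?T" "module_hom scale scale ?C"
    by (simp_all add: module_hom_iff module_axioms casimir_def op_linear chi_linear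
      scale_right_distrib scale_right_diff_distrib scale_left_commute)
qed (rule T_minus_eq_on_generators)

end

theorem theorem7:
  fixes scale :: "complex \<Rightarrow> 'v::ab_group_add \<Rightarrow> 'v"
    and Basis :: "'v set"
    and F H E Y U V W X chi :: "'v \<Rightarrow> 'v"
    and a :: nat and b :: complex and \<Lambda> :: 'v
  assumes "sl21_irrep scale Basis F H E Y U V W X chi"
    and "highest_weight_vector scale H E Y U a b \<Lambda>"
    and "chi \<Lambda> = \<Lambda>"
  shows "(U \<cdot> V + W \<cdot> X) \<cdot> (V \<cdot> U + X \<cdot> W)
    = scale (1/2) \<cdot> (id - chi) \<cdot> casimir scale F H E Y U V W X"
proof -
  interpret sl21_irrep scale Basis F H E Y U V W X chi by fact
  have nz: "\<Lambda> \<noteq> 0" and E: "E \<Lambda> = 0" and U: "U \<Lambda> = 0"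
    using assms(2) by (auto simp: highest_weight_vector_def)
  \<comment> \<open>\<open>W\<close> is the commutator of \<open>E\<close> and \<open>U\<close>,
    both of which kill \<Lambda>.\<close>
  have "W \<Lambda> = 0"
    using E_odd(1)[THEN comm_swap(1), of \<Lambda>] by (simp add: E U op_linear)
  then have "\<Lambda> \<in> span generators"
    using U assms(3) by (intro generators_memberI) (simp add: even_top_def)
  then have "span generators = UNIV"
    using irreducible[OF submodule_span_generators] nz by auto
  then show ?thesis
    by (intro ext T_minus_eq_on_span) simp
qed

end
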